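(* Let $D$ be a connected digraph and let $m=\max_{v \in V(D)} \max\{d_D^+(v),d_D^-(v)\}$. Moreover, let $s \geq 1$ be an integer and let $p= \lceil \frac{m}{s} \rceil$. If $D$ is neither a bidirected odd cycle, nor a bidirected complete graph, nor an Eulerian digraph in which every vertex has in-degree and out-degree $s$, then $\overrightarrow{\chi}_s(D) \leq p$.
   Context: Digraphs are finite and have no loops and no parallel arcs, but two opposite arcs between two vertices are allowed. $d_D^+(v)$ and $d_D^-(v)$ denote out-degree and in-degree. $D$ is connected if its underlying undirected graph is connected. $D$ is Eulerian if $d_D^+(v)=d_D^-(v)$ for every vertex $v$. A bidirected graph is a digraph obtained from a simple undirected graph by replacing each edge by two opposite arcs; a bidirected odd cycle comes from a cycle of odd length $\geq 3$ and a bidirected complete graph from $K_n$, $n\geq 1$. For an integer $s\geq 1$, a digraph is weakly $s$-degenerate if every non-empty subdigraph $D'$ contains a vertex $v$ with $\min\{d_{D'}^+(v),d_{D'}^-(v)\}<s$. A $p$-partition of $D$ is a sequence $(D_1,\ldots,D_p)$ of pairwise disjoint (possibly empty) induced subdigraphs of $D$ with $V(D)=V(D_1)\cup\ldots\cup V(D_p)$. The $s$-degenerate dichromatic number $\overrightarrow{\chi}_s(D)$ is the least integer $p$ such that $D$ admits a $p$-partition into weakly $s$-degenerate subdigraphs. *)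

theory Defs
  imports
    Complex_Main
    "HOL-Library.Disjoint_Sets"
    "Graph_Theory.Graph_Theory"
begin

definition eulerian :: "('a, 'b) pre_digraph \<Rightarrow> bool" where
  "eulerian D \<longleftrightarrow> (\<forall>v\<in>verts D. out_degree D v = in_degree D v)"

text \<open>
  \<open>bidirects V E D\<close>: the digraph \<open>D\<close> arises from the simple undirected graph with vertex
  set \<open>V\<close> and edge set \<open>E\<close> (a set of two-element subsets of \<open>V\<close>) by replacing each edge by two
  opposite arcs.
\<close>

definition bidirects :: "'a set \<Rightarrow> 'a set set \<Rightarrow> ('a, 'b) pre_digraph \<Rightarrow> bool" where
  "bidirects V E D \<longleftrightarrow>
     digraph D \<and> (\<forall>e\<in>E. e \<subseteq> V \<and> card e = 2) \<and>
     verts D = V \<and> arcs_ends D = {(u, v). {u, v} \<in> E}"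

definition cycle_edges :: "'a list \<Rightarrow> 'a set set" where
  "cycle_edges vs = {{vs ! i, vs ! (Suc i mod length vs)} | i. i < length vs}"

definition bidirected_odd_cycle :: "('a, 'b) pre_digraph \<Rightarrow> bool" where
  "bidirected_odd_cycle D \<longleftrightarrow>
     (\<exists>vs. distinct vs \<and> length vs \<ge> 3 \<and> odd (length vs) \<and>
           bidirects (set vs) (cycle_edges vs) D)"

definition bidirected_complete :: "('a, 'b) pre_digraph \<Rightarrow> bool" where
  "bidirected_complete D \<longleftrightarrow> (\<exists>n\<ge>1. complete_digraph n D)"

definition weakly_degenerate :: "nat \<Rightarrow> ('a, 'b) pre_digraph \<Rightarrow> bool" where
  "weakly_degenerate s D \<longleftrightarrow>
     (\<forall>H. subgraph H D \<and> verts H \<noteq> {} \<longrightarrow>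
        (\<exists>v\<in>verts H. min (out_degree H v) (in_degree H v) < s))"

text \<open>The sequence is \<open>P 1, \<dots>, P p\<close>; the values of \<open>P\<close> at other indices are irrelevant.\<close>

definition digraph_partition ::
    "nat \<Rightarrow> ('a, 'b) pre_digraph \<Rightarrow> (nat \<Rightarrow> ('a, 'b) pre_digraph) \<Rightarrow> bool" where
  "digraph_partition p D P \<longleftrightarrow>
     (\<forall>i\<in>{1..p}. induced_subgraph (P i) D) \<and>
     disjoint_family_on (\<lambda>i. verts (P i)) {1..p} \<and>
     verts D = (\<Union>i\<in>{1..p}. verts (P i))"

text \<open>
  For a finite loop-free \<open>D\<close> and \<open>s \<ge> 1\<close> the partition into single vertices qualifies, so the
  least element exists.
\<close>

definition dichromatic_number :: "nat \<Rightarrow> ('a, 'b) pre_digraph \<Rightarrow> nat" where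
  "dichromatic_number s D =
     (LEAST p. \<exists>P. digraph_partition p D P \<and> (\<forall>i\<in>{1..p}. weakly_degenerate s (P i)))"

end

theory Submission
  imports Defs
begin

text \<open>
  The argument is a Brooks-type recolouring argument with a moving hole. Call a set of vertices
  \<open>s\<close>-degenerate if it induces a weakly \<open>s\<close>-degenerate subdigraph. A vertex with fewer than \<open>s\<close>
  out-neighbours, or fewer than \<open>s\<close> in-neighbours, in an \<open>s\<close>-degenerate set can be added to it, so a
  vertex with fewer than \<open>q * s\<close> out- or in-neighbours in a \<open>q\<close>-colourable set can be added to that
  set as well. All degrees are at most \<open>p * s\<close>. Hence, in a connected digraph, everything except one
  prescribed vertex can be coloured greedily with \<open>p\<close> colours, working towards that vertex, and if a
  vertex has out- or in-degree below \<open>p * s\<close>, then it can be coloured last. What remains is the case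
  in which all degrees are \<open>p * s\<close>. For \<open>p = 1\<close> this is the excluded \<open>s\<close>-regular case,
  and for \<open>p = 0\<close> the digraph is a single vertex, hence complete.

  For \<open>p \<ge> 2\<close> the colours are grouped into two sides, one colour against the other \<open>p - 1\<close>.
  Let \<open>r i\<close> be the number of colours on side \<open>i\<close>, times \<open>s\<close>. Suppose that there is no colouring. A
  colouring of all vertices but a hole \<open>v\<close> then has exactly \<open>r i\<close> out- and \<open>r i\<close> in-neighbours
  of \<open>v\<close> on side \<open>i\<close>, and \<open>v\<close> can be put on side \<open>i\<close> in exchange for any neighbour there. Since the
  same holds for the new hole, the component of \<open>v\<close> on side \<open>i\<close> (with \<open>v\<close> added) is \<open>r i\<close>-regular,
  and the hole can move to any vertex of that component (\<open>state_move\<close>, \<open>state_regular\<close>).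

  Now let the hole walk, alternating between the sides, and always move it to a vertex that does not
  separate its current component. Finiteness forces the component of some hole \<open>v t\<close> to
  meet the remainder \<open>C\<close> of an earlier component, the one that was left through \<open>w = v (j + 1)\<close>.
  Regularity before and after shows that \<open>v t\<close> and \<open>w\<close> have the same in- and out-neighbours in \<open>C\<close>, and
  moving the hole through \<open>C\<close> to \<open>w\<close> shows that \<open>C\<close>, \<open>w\<close> and \<open>v t\<close> form bidirected cliques
  (\<open>twin_clique\<close>). The same argument applies to the component that was left one step later. If
  \<open>r True + r False \<ge> 3\<close>, these cliques fit together to a bidirected clique on
  \<open>r True + r False + 1\<close> vertices (\<open>return_clique\<close>), which has no room for further neighbours and
  hence is the whole digraph. If both \<open>r i\<close> are \<open>1\<close>, then the walk can return only to its starting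
  point, and it traces a bidirected odd cycle (\<open>unsplittable_odd_cycle\<close>).
\<close>

section \<open>Loopless relations, degrees and connectedness\<close>

locale loopless_relation =
  fixes V :: "'a set" and E :: "('a \<times> 'a) set"
  assumes finite_V: "finite V"
    and E_subset: "E \<subseteq> V \<times> V"
    and irrefl: "(v, v) \<notin> E"
begin

text \<open>
  The flag \<open>d\<close> selects a direction: \<open>True\<close> for outgoing and \<open>False\<close> for incoming arcs. All arguments
  below are symmetric under reversing the arcs, so both directions are treated at once.
\<close>

definition darc :: "bool \<Rightarrow> 'a \<Rightarrow> 'a \<Rightarrow> bool" where
  "darc d u v \<longleftrightarrow> (if d then (u, v) \<in> E else (v, u) \<in> E)"

definition deg :: "bool \<Rightarrow> 'a set \<Rightarrow> 'a \<Rightarrow> nat" where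
  "deg d S v = card {u \<in> S. darc d v u}"

definition adj :: "'a \<Rightarrow> 'a \<Rightarrow> bool" where
  "adj u v \<longleftrightarrow> (\<exists>d. darc d u v)"

definition linked :: "'a \<Rightarrow> 'a \<Rightarrow> bool" where
  "linked u v \<longleftrightarrow> (\<forall>d. darc d u v)"

definition biclique :: "'a set \<Rightarrow> bool" where
  "biclique Q \<longleftrightarrow> (\<forall>u\<in>Q. \<forall>v\<in>Q. u \<noteq> v \<longrightarrow> linked u v)"

text \<open>
  Connectedness of the underlying undirected graph, phrased through cuts: this form is inherited by
  adding a neighbour and gives invariants along paths without speaking of paths.
\<close>

definition conn :: "'a set \<Rightarrow> bool" where
  "conn S \<longleftrightarrow> (\<forall>A. A \<subseteq> S \<and> A \<noteq> {} \<and> A \<noteq> S \<longrightarrow> (\<exists>a\<in>A. \<exists>b\<in>S - A. adj a b))"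

definition closed_in :: "'a set \<Rightarrow> 'a set \<Rightarrow> bool" where
  "closed_in C S \<longleftrightarrow> C \<subseteq> S \<and> (\<forall>a\<in>C. \<forall>b\<in>S - C. \<not> adj a b)"

definition regular :: "nat \<Rightarrow> 'a set \<Rightarrow> bool" where
  "regular k S \<longleftrightarrow> (\<forall>d. \<forall>v\<in>S. deg d S v = k)"

lemma darc_flip: "darc d u v \<longleftrightarrow> darc (\<not> d) v u"
  by (simp add: darc_def)

lemma not_darc_self [simp]: "\<not> darc d v v"
  by (simp add: darc_def irrefl)

lemma adj_sym: "adj u v \<longleftrightarrow> adj v u"
  unfolding adj_def by (metis darc_flip)

lemma not_adj_self [simp]: "\<not> adj v v"
  by (simp add: adj_def)

lemma linked_sym: "linked u v \<longleftrightarrow> linked v u"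
  unfolding linked_def by (metis darc_flip)

lemma linked_adj: "linked u v \<Longrightarrow> adj u v"
  by (auto simp: linked_def adj_def)

lemma finite_sub: "S \<subseteq> V \<Longrightarrow> finite S"
  using finite_V finite_subset by blast

lemma deg_insert:
  assumes "finite S" "v \<notin> S"
  shows "deg d (insert v S) u = deg d S u + of_bool (darc d u v)"
proof -
  have "{w \<in> insert v S. darc d u w} = (if darc d u v then insert v {w \<in> S. darc d u w} else {w \<in> S. darc d u w})"
    by auto
  then show ?thesis using assms by (simp add: deg_def)
qed

lemma deg_mono: "finite T \<Longrightarrow> S \<subseteq> T \<Longrightarrow> deg d S v \<le> deg d T v"
  unfolding deg_def by (rule card_mono) auto

lemma deg_closed_in: "closed_in C S \<Longrightarrow> c \<in> C \<Longrightarrow> deg d S c = deg d C c"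
  unfolding deg_def by (rule arg_cong[where f = card]) (auto simp: closed_in_def adj_def)

lemma deg_remove_self: "deg d (S - {v}) v = deg d S v"
proof -
  have "{u \<in> S - {v}. darc d v u} = {u \<in> S. darc d v u}" by auto
  then show ?thesis by (simp add: deg_def)
qed

lemma deg_insert_self: "deg d (insert v S) v = deg d S v"
  using deg_remove_self[of d "insert v S" v] deg_remove_self[of d S v] by simp

lemma deg_union:
  "finite S \<Longrightarrow> finite T \<Longrightarrow> S \<inter> T = {} \<Longrightarrow> deg d (S \<union> T) v = deg d S v + deg d T v"
  unfolding deg_def by (subst card_Un_disjoint[symmetric]) (auto intro!: arg_cong[where f = card])

lemma conn_insert:
  assumes "conn T" "a \<in> T" "adj a b"
  shows "conn (insert b T)"
  unfolding conn_def
proof (intro allI impI)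
  fix A assume A: "A \<subseteq> insert b T \<and> A \<noteq> {} \<and> A \<noteq> insert b T"
  consider "A \<inter> T = {}" | "T \<subseteq> A" | "A \<inter> T \<noteq> {}" "A \<inter> T \<noteq> T" by blast
  then show "\<exists>a\<in>A. \<exists>b\<in>insert b T - A. adj a b"
  proof cases
    case 1
    then have "b \<in> A" "a \<notin> A" using A assms(2) by auto
    then show ?thesis using assms adj_sym by blast
  next
    case 2
    then have "b \<notin> A" using A by auto
    then show ?thesis using assms 2 by blast
  next
    case 3
    then obtain x y where "x \<in> A \<inter> T" "y \<in> T - A \<inter> T" "adj x y"
      using assms(1) unfolding conn_def by (metis inf_le2)
    then show ?thesis by blast
  qed
qed

lemma conn_singleton: "conn {v}"
  by (auto simp: conn_def subset_singleton_iff)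

lemma conn_propagate:
  assumes "conn T" "v \<in> T" "P v"
    and step: "\<And>a b. a \<in> T \<Longrightarrow> b \<in> T \<Longrightarrow> P a \<Longrightarrow> adj a b \<Longrightarrow> P b"
    and "u \<in> T"
  shows "P u"
proof (rule ccontr)
  assume "\<not> P u"
  then have "{w \<in> T. P w} \<subseteq> T" "{w \<in> T. P w} \<noteq> {}" "{w \<in> T. P w} \<noteq> T" using assms by auto
  then obtain a b where "a \<in> {w \<in> T. P w}" "b \<in> T - {w \<in> T. P w}" "adj a b"
    using assms(1) unfolding conn_def by meson
  then show False using step by blast
qed

text \<open>
  A maximal connected proper subset containing \<open>v\<close> misses only one vertex, because it can be
  extended by any neighbour.
\<close>

lemma conn_nonseparating:
  assumes "finite S" "conn S" "v \<in> S" "S \<noteq> {v}"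
  obtains u where "u \<in> S" "u \<noteq> v" "conn (S - {u})"
proof -
  define \<T> where "\<T> = {T. T \<subset> S \<and> v \<in> T \<and> conn T}"
  have "{v} \<in> \<T>" using assms conn_singleton by (auto simp: \<T>_def)
  moreover have "finite \<T>" using assms(1) by (rule finite_subset[rotated, OF finite_Pow_iff[THEN iffD2]]) (auto simp: \<T>_def)
  ultimately obtain T where T: "T \<in> \<T>" and max: "\<And>T'. T' \<in> \<T> \<Longrightarrow> T \<subseteq> T' \<Longrightarrow> T' = T"
    using finite_has_maximal[of \<T>] by blast
  have T': "T \<subset> S" "v \<in> T" "conn T" using T by (auto simp: \<T>_def)
  then have "T \<subseteq> S \<and> T \<noteq> {} \<and> T \<noteq> S" by blast
  then obtain a b where ab: "a \<in> T" "b \<in> S - T" "adj a b"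
    using assms(2) unfolding conn_def by meson
  have "conn (insert b T)" using conn_insert[OF T'(3) ab(1,3)] .
  moreover have "insert b T \<notin> \<T>" using max[of "insert b T"] ab by blast
  ultimately have "insert b T = S" using T' ab unfolding \<T>_def by blast
  then have "S - {b} = T" using ab by blast
  then show ?thesis using that[of b] T' ab by blast
qed

lemma component_exists:
  assumes "finite S" "v \<in> S"
  obtains K where "v \<in> K" "conn K" "closed_in K S"
proof -
  define \<T> where "\<T> = {T. T \<subseteq> S \<and> v \<in> T \<and> conn T}"
  have "{v} \<in> \<T>" using assms conn_singleton by (auto simp: \<T>_def)
  moreover have "finite \<T>" using assms(1) by (rule finite_subset[rotated, OF finite_Pow_iff[THEN iffD2]]) (auto simp: \<T>_def)
  ultimately obtain T where T: "T \<in> \<T>" and max: "\<And>T'. T' \<in> \<T> \<Longrightarrow> T \<subseteq> T' \<Longrightarrow> T' = T"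
    using finite_has_maximal[of \<T>] by blast
  have "\<not> adj a b" if "a \<in> T" "b \<in> S - T" for a b
  proof
    assume "adj a b"
    then have "insert b T \<in> \<T>" using conn_insert[of T a b] T that unfolding \<T>_def by blast
    then show False using max[of "insert b T"] that by blast
  qed
  then show ?thesis using that[of T] T unfolding \<T>_def closed_in_def by blast
qed

end

section \<open>Splitting the vertices into two families\<close>

text \<open>
  \<open>F i\<close> abstracts the sets that can be coloured with the colours of side \<open>i\<close>. The recolouring argument
  uses of them only that they contain the empty set, are closed under subsets and admit the addition of
  any vertex of degree below \<open>r i\<close> in one of the two directions.
\<close>

locale split_families = loopless_relation +
  fixes F :: "bool \<Rightarrow> 'a set \<Rightarrow> bool" and r :: "bool \<Rightarrow> nat"
  assumes F_empty: "F i {}"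
    and F_mono: "F i X \<Longrightarrow> Y \<subseteq> X \<Longrightarrow> F i Y"
    and F_extend: "F i X \<Longrightarrow> X \<subseteq> V \<Longrightarrow> v \<in> V - X \<Longrightarrow> deg d X v < r i \<Longrightarrow> F i (insert v X)"
    and deg_le: "v \<in> V \<Longrightarrow> deg d V v \<le> r True + r False"
    and conn_V: "conn V"
begin

definition split_of :: "(bool \<Rightarrow> 'a set) \<Rightarrow> 'a set \<Rightarrow> bool" where
  "split_of X W \<longleftrightarrow> (\<forall>i. F i (X i)) \<and> X True \<inter> X False = {} \<and> X True \<union> X False = W"

lemma split_extend:
  assumes "split_of X W" "W \<subseteq> V" "v \<in> V - W" "deg d W v < r True + r False"
  shows "\<exists>X. split_of X (insert v W)"
proof -
  have fin: "finite (X True)" "finite (X False)" and sub: "X i \<subseteq> W" for i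
    using assms(1,2) finite_sub unfolding split_of_def by (blast, blast, cases i) auto
  have "deg d (X True) v + deg d (X False) v = deg d W v"
    using assms(1) deg_union[OF fin] unfolding split_of_def by simp
  then obtain i where "deg d (X i) v < r i" using assms(4) by (metis add_mono_thms_linordered_semiring(1) not_less)
  moreover have "F i (X i)" "X i \<subseteq> V" "v \<in> V - X i" using assms sub unfolding split_of_def by auto
  ultimately have "F i (insert v (X i))" using F_extend by blast
  then have "split_of (X(i := insert v (X i))) (insert v W)"
    using assms(1,3) unfolding split_of_def by (cases i) auto
  then show ?thesis by blast
qed

text \<open>
  Greedy colouring: the uncoloured set \<open>T\<close> is kept connected and shrinks to \<open>{v}\<close>. A vertex \<open>u\<close> that is
  removed from \<open>T\<close> without separating it still has an uncoloured neighbour, so one of its two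
  degrees into the coloured part is too small to block both sides.
\<close>

lemma split_except_one:
  assumes "v \<in> V"
  shows "\<exists>X. split_of X (V - {v})"
proof -
  have "\<exists>X. split_of X (V - {v})" if "T \<subseteq> V" "v \<in> T" "conn T" "\<exists>X. split_of X (V - T)" for T
    using that
  proof (induction "card T" arbitrary: T rule: less_induct)
    case less
    show ?case
    proof (cases "T = {v}")
      case False
      have "finite T" using less.prems finite_sub by blast
      then obtain u where u: "u \<in> T" "u \<noteq> v" "conn (T - {u})"
        using conn_nonseparating less.prems False by metis
      have "\<exists>a\<in>{u}. \<exists>b\<in>T - {u}. adj a b" using less.prems(3) u less.prems(2) unfolding conn_def by blast
      then obtain b d where b: "b \<in> T - {u}" "darc d u b" unfolding adj_def by blast
      have "{w \<in> V - T. darc d u w} \<subset> {w \<in> V. darc d u w}" using b less.prems(1) by blast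
      then have "deg d (V - T) u < deg d V u" unfolding deg_def using finite_V by (intro psubset_card_mono) auto
      also have "\<dots> \<le> r True + r False" using deg_le u less.prems(1) by blast
      finally have "\<exists>X. split_of X (insert u (V - T))"
        using split_extend[of _ "V - T" u d] u less.prems by blast
      moreover have "insert u (V - T) = V - (T - {u})" using u less.prems by blast
      ultimately show ?thesis
        using less.hyps[of "T - {u}"] u less.prems(1,2) card_Diff1_less[OF \<open>finite T\<close> u(1)] by auto
    qed (use less.prems in blast)
  qed
  moreover have "split_of (\<lambda>_. {}) (V - V)" using F_empty by (simp add: split_of_def)
  ultimately show ?thesis using assms conn_V by blast
qed

lemma split_low_degree:
  assumes "v \<in> V" "deg d V v < r True + r False"
  shows "\<exists>X. split_of X V"
proof -
  obtain X where X: "split_of X (V - {v})" using split_except_one[OF assms(1)] ..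
  have "\<exists>X. split_of X (insert v (V - {v}))"
    by (rule split_extend[OF X, of v d]) (use assms in \<open>simp_all add: deg_remove_self\<close>)
  then show ?thesis using assms by (simp add: insert_absorb)
qed

end

section \<open>States with one hole\<close>

text \<open>
  The hypothetical counterexample. By \<open>split_low_degree\<close> all its degrees are equal to
  \<open>r True + r False\<close>, which is why the vertices adjacent to a hole are distributed so rigidly.
\<close>

locale unsplittable = split_families +
  assumes r_pos: "r i \<ge> 1"
    and nosplit: "\<not> split_of X V"
    and V_nonempty: "V \<noteq> {}"
begin

definition state :: "(bool \<Rightarrow> 'a set) \<Rightarrow> 'a \<Rightarrow> bool" where
  "state X v \<longleftrightarrow> v \<in> V \<and> split_of X (V - {v})"

lemma deg_V: "v \<in> V \<Longrightarrow> deg d V v = r True + r False"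
  using split_low_degree[of v d] nosplit deg_le[of v d] by fastforce

lemma state_in_V: "state X v \<Longrightarrow> v \<in> V"
  by (simp add: state_def)

lemma state_F: "state X v \<Longrightarrow> F i (X i)"
  by (simp add: state_def split_of_def)

lemma state_sub: "state X v \<Longrightarrow> X i \<subseteq> V - {v}"
  unfolding state_def split_of_def by (cases i) auto

lemma state_fin: "state X v \<Longrightarrow> finite (X i)"
  using state_sub finite_sub by blast

lemma state_disj: "state X v \<Longrightarrow> X i \<inter> X (\<not> i) = {}"
  unfolding state_def split_of_def by (cases i) auto

text \<open>
  Neither side can take the hole, so the hole has at least \<open>r i\<close> neighbours on each side in each
  direction, and its total degree leaves no slack.
\<close>

lemma state_deg:
  assumes "state X v"
  shows "deg d (X i) v = r i"
proof -
  have ge: "r i \<le> deg d (X i) v" for i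
  proof (rule ccontr)
    assume "\<not> r i \<le> deg d (X i) v"
    then have "F i (insert v (X i))"
      using F_extend[of i "X i" v d] assms state_sub[OF assms, of i] unfolding state_def split_of_def by auto
    then have "split_of (X(i := insert v (X i))) V"
      using assms unfolding state_def split_of_def by (cases i) auto
    then show False using nosplit by blast
  qed
  have "deg d (X True) v + deg d (X False) v = deg d V v"
    using assms deg_union[OF state_fin[OF assms] state_fin[OF assms], of True False d v]
    unfolding state_def split_of_def by (simp add: deg_remove_self)
  then have "deg d (X True) v + deg d (X False) v = r True + r False"
    using deg_V assms unfolding state_def by simp
  then show ?thesis using ge[of True] ge[of False] by (cases i) auto
qed

abbreviation (input) swapped where
  "swapped X i v u \<equiv> X(i := insert v (X i) - {u})"

text \<open>
  Once \<open>u\<close> is gone, \<open>v\<close> has fewer than \<open>r i\<close> neighbours on side \<open>i\<close> in one direction and fits in.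
\<close>

lemma state_shift:
  assumes "state X v" "u \<in> X i" "adj v u"
  shows "state (swapped X i v u) u"
proof -
  obtain d where d: "darc d v u" using assms adj_def by blast
  have "{w \<in> X i - {u}. darc d v w} \<subset> {w \<in> X i. darc d v w}" using assms d by blast
  then have "deg d (X i - {u}) v < deg d (X i) v"
    unfolding deg_def using state_fin[OF assms(1)] by (intro psubset_card_mono) auto
  then have "deg d (X i - {u}) v < r i" using state_deg[OF assms(1)] by simp
  moreover have "F i (X i - {u})" by (rule F_mono[OF state_F[OF assms(1)]]) simp
  moreover have "X i - {u} \<subseteq> V" "v \<in> V - (X i - {u})"
    using state_sub[OF assms(1), of i] state_in_V[OF assms(1)] by auto
  ultimately have "F i (insert v (X i - {u}))" by (intro F_extend)
  moreover have "insert v (X i - {u}) = insert v (X i) - {u}"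
    using state_sub[OF assms(1), of i] assms(2) by blast
  ultimately have "F j (swapped X i v u j)" for j
    using state_F[OF assms(1)] by simp
  moreover have u: "u \<in> V" "u \<noteq> v" "u \<notin> X (\<not> i)"
    using state_sub[OF assms(1), of i] state_disj[OF assms(1), of i] assms(2) by blast+
  moreover have "v \<in> V" "v \<notin> X True" "v \<notin> X False" "X True \<inter> X False = {}" "X True \<union> X False = V - {v}"
    using assms(1) state_sub[OF assms(1)] unfolding state_def split_of_def by auto
  ultimately show ?thesis unfolding state_def split_of_def
    by (cases i; simp; blast)
qed

text \<open>
  Successive shifts along a connected set never involve vertices outside the set, so only the
  final position of the hole matters.
\<close>

lemma state_move:
  assumes "state X v" "conn K" "v \<in> K" "K \<subseteq> insert v (X i)" "u \<in> K"
  shows "state (swapped X i v u) u"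
proof (rule conn_propagate[OF assms(2,3) _ _ assms(5)])
  have "insert v (X i) - {v} = X i" using state_sub[OF assms(1)] by blast
  then show "state (swapped X i v v) v" using assms(1) by simp
next
  fix a b assume *: "a \<in> K" "b \<in> K" "state (swapped X i v a) a" "adj a b"
  then have "a \<noteq> b" by auto
  have "state (swapped (swapped X i v a) i a b) b"
    using state_shift[of "swapped X i v a" a b i] * assms(4) \<open>a \<noteq> b\<close> by auto
  moreover have "swapped (swapped X i v a) i a b = swapped X i v b"
    using * assms(4) by (auto simp: fun_eq_iff)
  ultimately show "state (swapped X i v b) b" by simp
qed

lemma state_regular:
  assumes "state X v" "conn K" "v \<in> K" "K \<subseteq> insert v (X i)" "u \<in> K"
  shows "deg d (insert v (X i)) u = r i"
  using state_deg[OF state_move[OF assms], of d i] by (simp only: fun_upd_same deg_remove_self)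

lemma conn_pair: "adj u v \<Longrightarrow> conn {u, v}"
  using conn_insert[OF conn_singleton, of u u v] by (metis insert_commute insertI1)

lemma state_neighbour_regular:
  assumes "state X v" "u \<in> X i" "adj v u"
  shows "deg d (insert v (X i)) u = r i"
  by (rule state_regular[OF assms(1) conn_pair[OF assms(3)]]) (use assms(2) in simp_all)

section \<open>Twins of the hole\<close>

text \<open>
  Two vertices that both complete \<open>C\<close> to an \<open>r i\<close>-regular set have the same neighbours in \<open>C\<close>, since
  the degree that a vertex of \<open>C\<close> has inside \<open>C\<close> determines which arcs are still missing. Here \<open>h\<close>
  completes \<open>C\<close> because it is a hole adjacent to \<open>C\<close>, and \<open>w\<close> does so by assumption.
\<close>

lemma socket_transfer:
  assumes st: "state X h" and C: "closed_in C (X i)" "conn C" and c0: "c0 \<in> C" "adj c0 h"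
    and w: "w \<notin> C" "regular (r i) (insert w C)"
  shows "c \<in> C \<Longrightarrow> darc d c w \<longleftrightarrow> darc d c h"
    and "c \<in> C \<Longrightarrow> deg d (insert h C) c = r i"
    and "deg d C w = r i"
proof -
  have CX: "C \<subseteq> X i" using C(1) by (simp add: closed_in_def)
  have fin: "finite (X i)" "finite C" using state_fin[OF st] CX finite_subset by blast+
  have h: "h \<notin> X i" "h \<notin> C" using state_sub[OF st, of i] CX by blast+
  have K: "conn (insert h C)" "insert h C \<subseteq> insert h (X i)"
    using conn_insert[OF C(2) c0] CX by auto
  have eqs: "(darc d c w \<longleftrightarrow> darc d c h) \<and> deg d (insert h C) c = r i" if c: "c \<in> C" for c d
  proof -
    have "deg d (insert h (X i)) c = r i" using state_regular[OF st K(1) _ K(2)] c by blast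
    then have 1: "deg d C c + of_bool (darc d c h) = r i"
      using deg_insert[OF fin(1) h(1)] deg_closed_in[OF C(1) c] by simp
    have "deg d (insert w C) c = r i" using w(2) c by (simp add: regular_def)
    then have "deg d C c + of_bool (darc d c w) = r i" using deg_insert[OF fin(2) w(1)] by simp
    then have "of_bool (darc d c h) = (of_bool (darc d c w) :: nat)" using 1 by linarith
    then show ?thesis using 1 deg_insert[OF fin(2) h(2)] by (auto simp: of_bool_eq_iff)
  qed
  show "darc d c w \<longleftrightarrow> darc d c h" if "c \<in> C" using eqs[OF that] by blast
  show "deg d (insert h C) c = r i" if "c \<in> C" using eqs[OF that] by blast
  show "deg d C w = r i" using w(2) deg_insert_self[of d w C] by (simp add: regular_def)
qed

text \<open>
  Moving the hole from \<open>h\<close> to \<open>z\<close> and then, on the other side, to \<open>w\<close> replaces \<open>z\<close> by \<open>w\<close> in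
  side \<open>i\<close> with the hole included. A vertex \<open>u\<close> that is regular both before and after sees \<open>w\<close> as it saw \<open>z\<close>.
\<close>

lemma swap_transfer:
  assumes "state X h" "z \<in> X i" "adj h z" "w \<in> X (\<not> i)" "adj z w"
    and K: "conn K" "w \<in> K" "K \<subseteq> insert w (insert h (X i) - {z})"
    and u: "u \<in> K" "deg d (insert h (X i)) u = r i"
  shows "darc d u w \<longleftrightarrow> darc d u z"
proof -
  define Y where "Y = insert h (X i) - {z}"
  have w: "w \<noteq> h" "w \<notin> X i"
    using state_sub[OF assms(1), of "\<not> i"] state_disj[OF assms(1), of i] assms(4) by blast+
  have st: "state (swapped (swapped X i h z) (\<not> i) z w) w"
    by (rule state_shift[OF state_shift[OF assms(1,2,3)]]) (use assms(4,5) in simp_all)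
  have "deg d (insert w Y) u = r i"
    using state_regular[OF st K(1,2) _ u(1), of i d] K(3) by (simp add: Y_def)
  moreover have "insert h (X i) = insert z Y" using assms(2) by (auto simp: Y_def)
  moreover have "finite Y" "w \<notin> Y" "z \<notin> Y" using state_fin[OF assms(1), of i] w by (auto simp: Y_def)
  ultimately have "deg d Y u + of_bool (darc d u w) = deg d Y u + of_bool (darc d u z)"
    using u(2) by (metis deg_insert)
  then show ?thesis by (simp add: of_bool_eq_iff)
qed

text \<open>
  Let \<open>Z\<close> be the set of neighbours of \<open>w\<close> in \<open>C\<close>, which are also those of \<open>h\<close>. With the hole at any
  \<open>z \<in> Z\<close>, the vertex \<open>w\<close> is regular on the other side, so whether \<open>w\<close> has an arc to (or from) \<open>z\<close> does not
  depend on \<open>z\<close>; as \<open>w\<close> has both kinds of arcs into \<open>C\<close>, it is linked to all of \<open>Z\<close> in both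
  directions. Moving on from \<open>z\<close> to \<open>w\<close> turns these links into links between the
  elements of \<open>Z\<close>. Then every element of \<open>Z\<close> has its \<open>r i\<close> neighbours in \<open>Z\<close> and \<open>h\<close>, and connectedness
  of \<open>C\<close> gives \<open>Z = C\<close>.
\<close>

lemma twin_clique:
  assumes st: "state X h" and C: "closed_in C (X i)" "conn C" and c0: "c0 \<in> C" "adj c0 h"
    and w: "w \<in> X (\<not> i)" "regular (r i) (insert w C)"
  shows "biclique (insert h C)" "biclique (insert w C)" "card C = r i"
proof -
  have CX: "C \<subseteq> X i" using C(1) by (simp add: closed_in_def)
  have fin: "finite (X (\<not> i))" "finite C" using state_fin[OF st] CX finite_subset by blast+
  have wC: "w \<notin> C" "w \<noteq> h"
    using CX state_disj[OF st, of i] state_sub[OF st, of "\<not> i"] w(1) by blast+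
  have hX: "h \<notin> X j" for j using state_sub[OF st, of j] by blast
  note tr = socket_transfer[OF st C c0 wC(1) w(2)]
  have tr': "darc d h c \<longleftrightarrow> darc d w c" if "c \<in> C" for c d
    using tr(1)[OF that, of "\<not> d"] by (metis darc_flip)
  have adj_tr: "adj h c \<longleftrightarrow> adj w c" if "c \<in> C" for c
    using tr'[OF that] by (simp add: adj_def)
  define Z where "Z = {z \<in> C. adj w z}"
  have ZX: "z \<in> X i" "adj h z" "adj w z" "adj z w" if "z \<in> Z" for z
    using that CX adj_tr[of z] adj_sym[of z w] unfolding Z_def by auto
  have deg_w: "deg d (X (\<not> i)) w + of_bool (darc d w z) = r (\<not> i)" if z: "z \<in> Z" for z d
  proof -
    have st1: "state (swapped X i h z) z" by (rule state_shift[OF st ZX(1,2)[OF z]])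
    have "z \<notin> X (\<not> i)" using ZX(1)[OF z] state_disj[OF st, of i] by blast
    then show ?thesis
      using state_neighbour_regular[OF st1, of w "\<not> i" d] w(1) ZX(4)[OF z] deg_insert[OF fin(1)] by simp
  qed
  have w_Z: "darc d w z" if z: "z \<in> Z" for z d
  proof -
    have "deg d C w \<noteq> 0" using tr(3)[of d] r_pos[of i] by simp
    then have "{u \<in> C. darc d w u} \<noteq> {}" unfolding deg_def by (metis card.empty)
    then obtain y where "y \<in> C" "darc d w y" by blast
    then have "y \<in> Z" by (auto simp: Z_def adj_def)
    have "of_bool (darc d w z) = (of_bool (darc d w y) :: nat)"
      using deg_w[OF z, of d] deg_w[OF \<open>y \<in> Z\<close>, of d] by linarith
    then show ?thesis using \<open>darc d w y\<close> by (metis of_bool_eq_iff)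
  qed
  have cardZ: "card Z = r i"
  proof -
    have "Z = {u \<in> C. darc True w u}" using w_Z by (auto simp: Z_def adj_def)
    then show ?thesis using tr(3)[of True] by (simp add: deg_def)
  qed
  have Z_clique: "darc d z' z" if z: "z \<in> Z" "z' \<in> Z" "z' \<noteq> z" for z z' d
  proof -
    have "deg d (insert h (X i)) z' = r i"
      by (rule state_neighbour_regular[OF st ZX(1,2)[OF z(2)]])
    then have "darc d z' w \<longleftrightarrow> darc d z' z"
      using swap_transfer[OF st ZX(1,2)[OF z(1)] w(1) ZX(4)[OF z(1)] conn_pair[OF ZX(3)[OF z(2)]], of z' d]
        ZX(1)[OF z(2)] z(3) by auto
    then show ?thesis using w_Z[OF z(2), of "\<not> d"] by (metis darc_flip)
  qed
  have h_Z: "darc d h z" if "z \<in> Z" for z d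
    using w_Z[OF that] tr' that unfolding Z_def by blast
  have "Z = C"
  proof (rule ccontr)
    assume "Z \<noteq> C"
    moreover have "Z \<subseteq> C" by (auto simp: Z_def)
    moreover have "Z \<noteq> {}" using cardZ r_pos[of i] by auto
    ultimately obtain a b where ab: "a \<in> Z" "b \<in> C - Z" "adj a b"
      using C(2) unfolding conn_def by meson
    then obtain d where d: "darc d a b" by (auto simp: adj_def)
    have finZ: "finite Z" using fin(2) \<open>Z \<subseteq> C\<close> finite_subset by blast
    have hC: "h \<notin> C" using hX CX by blast
    \<comment> \<open>In direction \<open>d\<close> the vertex \<open>a\<close> has \<open>r i\<close> neighbours in \<open>h\<close> and \<open>Z\<close>, and \<open>b\<close> is one too many.\<close>
    have "insert h (insert b (Z - {a})) \<subseteq> {u \<in> insert h C. darc d a u}"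
      using ab d Z_clique[of _ a] \<open>Z \<subseteq> C\<close> h_Z[OF ab(1), of "\<not> d"] by (auto simp: darc_flip[of d a h])
    then have "card (insert h (insert b (Z - {a}))) \<le> deg d (insert h C) a"
      unfolding deg_def using fin(2) by (intro card_mono) auto
    also have "\<dots> = r i" using tr(2) ab(1) \<open>Z \<subseteq> C\<close> by blast
    finally have "card (insert h (insert b (Z - {a}))) \<le> r i" .
    moreover have "card (insert h (insert b (Z - {a}))) = card Z + 1"
      using ab finZ hC \<open>Z \<subseteq> C\<close> card_Suc_Diff1[OF finZ ab(1)] by (subst card_insert_disjoint, simp, blast)+ simp
    ultimately show False using cardZ by simp
  qed
  then show "card C = r i" using cardZ by simp
  have lk: "linked h z" "linked w z" "linked z h" "linked z w" if "z \<in> C" for z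
    using h_Z w_Z that \<open>Z = C\<close> by (simp_all add: linked_def darc_flip[of _ z])
  have lkZ: "linked z z'" if "z \<in> C" "z' \<in> C" "z \<noteq> z'" for z z'
    using Z_clique that \<open>Z = C\<close> by (simp add: linked_def)
  show "biclique (insert h C)" "biclique (insert w C)"
    unfolding biclique_def using lk lkZ by auto
qed

text \<open>
  Move the hole from \<open>h\<close> to \<open>z \<in> C\<close> and on to \<open>w\<close>. A second vertex \<open>z'\<close> of \<open>C\<close> keeps \<open>h\<close> in the component
  of the hole, and \<open>h\<close> has lost its neighbour \<open>z\<close>, which only \<open>w\<close> can make up for.
\<close>

lemma twins_linked:
  assumes st: "state X h" and C: "C \<subseteq> X i" "card C \<ge> 2"
    and cl: "biclique (insert h C)" "biclique (insert w C)" and w: "w \<in> X (\<not> i)"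
  shows "linked h w"
proof -
  have wC: "w \<notin> C" "w \<noteq> h" and hC: "h \<notin> C"
    using C(1) state_disj[OF st, of i] state_sub[OF st, of "\<not> i"] state_sub[OF st, of i] w by blast+
  obtain z z' where z: "z \<in> C" "z' \<in> C" "z \<noteq> z'"
    using C(2) by (metis obtain_subset_with_card_n card_2_iff insert_subset)
  then have "h \<noteq> z" "h \<noteq> z'" "w \<noteq> z" "w \<noteq> z'" using wC hC by auto
  then have lk: "linked h z" "linked h z'" "linked w z" "linked w z'" "linked z w" "linked z' h"
    using cl z unfolding biclique_def by auto
  have "conn (insert h {w, z'})"
    using conn_insert[OF conn_pair[of w z'], of z' h] lk linked_adj by blast
  have "darc d h w \<longleftrightarrow> darc d h z" for d
  proof (rule swap_transfer[OF st])
    show "deg d (insert h (X i)) h = r i" using state_deg[OF st] by (simp add: deg_insert_self)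
    show "conn (insert h {w, z'})" by fact
  qed (use z C(1) lk linked_adj w hC in auto)
  then show ?thesis using lk(1) by (simp add: linked_def)
qed

text \<open>
  \<open>C\<close> and \<open>B\<close> are components of the two sides, \<open>w \<in> B\<close> is a twin of the hole \<open>h\<close> for \<open>C\<close>, and \<open>x\<close> is a
  twin for \<open>B\<close> of every hole \<open>z \<in> C\<close>. Both pairs give cliques, and together they give a clique on
  \<open>B \<union> C\<close> with \<open>r True + r False\<close> vertices. The last vertex is \<open>h\<close> if \<open>C\<close> is large enough
  for \<open>twins_linked\<close>. Otherwise \<open>C\<close> is a single vertex \<open>z\<close>, and the roles of the sides are exchanged:
  the last vertex is then \<open>x\<close>.
\<close>

lemma return_clique:
  assumes st: "state X h" and big: "r True + r False \<ge> 3"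
    and C: "closed_in C (X i)" "conn C" and c0: "c0 \<in> C" "adj c0 h"
    and w: "w \<in> B" "regular (r i) (insert w C)"
    and B: "closed_in B (X (\<not> i))" "conn B"
    and x: "x \<in> insert h (X i) - C" "regular (r (\<not> i)) (insert x B)"
  shows "\<exists>Q\<subseteq>V. biclique Q \<and> card Q = r True + r False + 1"
proof -
  have CX: "C \<subseteq> X i" and BX: "B \<subseteq> X (\<not> i)" using C(1) B(1) by (simp_all add: closed_in_def)
  have hX: "h \<notin> X j" for j using state_sub[OF st, of j] by blast
  have disj: "B \<inter> C = {}" "h \<notin> B" "h \<notin> C" using CX BX state_disj[OF st, of i] hX by blast+
  have fin: "finite B" "finite C" using state_fin[OF st] CX BX finite_subset by blast+
  have sub: "insert h (B \<union> C) \<subseteq> V" "X i \<subseteq> V"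
    using CX BX state_sub[OF st, of i] state_sub[OF st, of "\<not> i"] state_in_V[OF st] by blast+
  have wX: "w \<in> X (\<not> i)" using w(1) BX by blast
  note A = twin_clique[OF st C c0 wX w(2)]
  have sum: "r i + r (\<not> i) = r True + r False" by (cases i) auto
  have st1: "state (swapped X i h z) z" if "z \<in> C" for z
  proof (rule state_shift[OF st])
    show "z \<in> X i" using that CX by blast
    have "h \<noteq> z" using that disj by blast
    then show "adj h z" using A(1) that linked_adj[of h z] unfolding biclique_def by blast
  qed
  have A': "biclique (insert z B)" "biclique (insert x B)" "card B = r (\<not> i)" if z: "z \<in> C" for z
  proof -
    have "w \<noteq> z" using z w(1) disj by blast
    then have "adj w z" using A(2) z linked_adj[of w z] unfolding biclique_def by blast
    moreover have "x \<noteq> z" using x(1) z by blast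
    ultimately show "biclique (insert z B)" "biclique (insert x B)" "card B = r (\<not> i)"
      using twin_clique[OF st1[OF z], of B "\<not> i" w x] B w(1) x by auto
  qed
  have BC: "biclique (B \<union> C)"
    using A(1) A'(1) c0(1) unfolding biclique_def by blast
  show ?thesis
  proof (cases "r i \<ge> 2")
    case True
    have "linked h b" if "b \<in> B" for b
    proof (rule twins_linked[OF st CX _ A(1)])
      show "biclique (insert b C)" using BC that unfolding biclique_def by blast
      show "b \<in> X (\<not> i)" using that BX by blast
    qed (use True A(3) in simp)
    then have "biclique (insert h (B \<union> C))"
      using BC A(1) linked_sym unfolding biclique_def by blast
    moreover have "card (insert h (B \<union> C)) = r True + r False + 1"
      using card_Un_disjoint[OF fin disj(1)] disj A(3) A'(3)[OF c0(1)] fin sum by simp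
    ultimately show ?thesis using sub(1) by blast
  next
    case False
    then have r1: "r i = 1" using r_pos[of i] by simp
    define z where "z = c0"
    have z: "z \<in> C" "x \<noteq> z" using c0(1) x(1) by (auto simp: z_def)
    have "linked z x"
    proof (rule twins_linked[OF st1[OF z(1)], of B "\<not> i"])
      show "card B \<ge> 2" using A'(3)[OF z(1)] big sum r1 by simp
      show "B \<subseteq> swapped X i h z (\<not> i)" using BX by simp
      show "x \<in> swapped X i h z (\<not> \<not> i)" using x(1) z by simp
    qed (use A' z in blast)+
    then have "biclique (insert x (insert z B))"
      using A'(1,2)[OF z(1)] linked_sym unfolding biclique_def by blast
    moreover have xB: "x \<notin> B" "z \<notin> B" using x(1) BX state_disj[OF st, of i] hX disj z by blast+
    then have "card (insert x (insert z B)) = r True + r False + 1"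
      using z A'(3)[OF z(1)] fin sum r1 by simp
    moreover have "insert x (insert z B) \<subseteq> V" using sub x(1) z by blast
    ultimately show ?thesis by blast
  qed
qed

lemma saturated_clique:
  assumes "Q \<subseteq> V" "biclique Q" "card Q = r True + r False + 1"
  shows "biclique V"
proof -
  have "Q = V"
  proof (rule ccontr)
    assume "Q \<noteq> V"
    moreover have "Q \<noteq> {}" using assms(3) by auto
    ultimately obtain a b where ab: "a \<in> Q" "b \<in> V - Q" "adj a b"
      using conn_V assms(1) unfolding conn_def by meson
    then obtain d where d: "darc d a b" by (auto simp: adj_def)
    have fin: "finite Q" using finite_sub assms(1) by blast
    have "darc d a u" if "u \<in> Q - {a}" for u
      using assms(2) ab(1) that by (auto simp: biclique_def linked_def)
    then have "insert b (Q - {a}) \<subseteq> {u \<in> V. darc d a u}"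
      using ab(2) d assms(1) by auto
    then have "card (insert b (Q - {a})) \<le> deg d V a"
      unfolding deg_def using finite_V by (intro card_mono) auto
    moreover have "card (insert b (Q - {a})) = card Q"
      using ab fin card_Suc_Diff1[OF fin ab(1)] by simp
    ultimately show False using deg_V[of a d] ab(1) assms(1,3) by auto
  qed
  then show ?thesis using assms(2) by simp
qed

section \<open>Alternating walks of the hole\<close>

definition side :: "bool \<Rightarrow> nat \<Rightarrow> bool" where
  "side i k = (if even k then i else \<not> i)"

lemma side_0 [simp]: "side i 0 = i" and side_Suc [simp]: "side i (Suc k) = (\<not> side i k)"
  by (simp_all add: side_def)

lemma side_add: "side (side i k) n = side i (n + k)"
  by (simp add: side_def)

text \<open>
  At time \<open>k\<close> the hole is \<open>v k\<close>, its component on the side whose turn it is (the hole included) is \<open>K k\<close>, and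
  it moves on to a vertex whose removal does not disconnect \<open>K k\<close>. The trail \<open>K k - {v (Suc k)}\<close>
  is what the walk leaves behind; it contains \<open>v k\<close>.
\<close>

definition walk :: "bool \<Rightarrow> (nat \<Rightarrow> bool \<Rightarrow> 'a set) \<Rightarrow> (nat \<Rightarrow> 'a) \<Rightarrow> (nat \<Rightarrow> 'a set) \<Rightarrow> bool" where
  "walk i X v K \<longleftrightarrow> (\<forall>k. state (X k) (v k) \<and> conn (K k) \<and> v k \<in> K k \<and>
     closed_in (K k) (insert (v k) (X k (side i k))) \<and>
     v (Suc k) \<in> K k \<and> v (Suc k) \<noteq> v k \<and> conn (K k - {v (Suc k)}) \<and>
     X (Suc k) = swapped (X k) (side i k) (v k) (v (Suc k)))"

lemma walkD:
  assumes "walk i X v K"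
  shows "state (X k) (v k)" "conn (K k)" "v k \<in> K k"
    "closed_in (K k) (insert (v k) (X k (side i k)))" "K k \<subseteq> insert (v k) (X k (side i k))"
    "v (Suc k) \<in> K k" "v (Suc k) \<noteq> v k" "conn (K k - {v (Suc k)})"
    "X (Suc k) = swapped (X k) (side i k) (v k) (v (Suc k))"
    "v k \<notin> X k j"
  using assms state_sub[of "X k" "v k" j] unfolding walk_def closed_in_def by blast+

lemma component_regular:
  assumes "state X v" "conn K" "v \<in> K" "closed_in K (insert v (X i))"
  shows "regular (r i) K"
  unfolding regular_def
proof (intro allI ballI)
  fix d u assume u: "u \<in> K"
  have "K \<subseteq> insert v (X i)" using assms(4) by (simp add: closed_in_def)
  then show "deg d K u = r i"
    using state_regular[OF assms(1-3) _ u] deg_closed_in[OF assms(4) u] by simp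
qed

lemma walk_exists:
  assumes "state X0 v0"
  shows "\<exists>X v K. walk i X v K \<and> X 0 = X0 \<and> v 0 = v0"
proof -
  \<comment> \<open>\<open>P\<close> is the invariant at time \<open>n\<close> and \<open>Q\<close> the step relation of a sequence built by dependent choice.\<close>
  define P where "P n s \<longleftrightarrow> (case s of (X, v, K) \<Rightarrow>
    state X v \<and> conn K \<and> v \<in> K \<and> closed_in K (insert v (X (side i n))) \<and> (n = 0 \<longrightarrow> X = X0 \<and> v = v0))"
    for n :: nat and s :: "(bool \<Rightarrow> 'a set) \<times> 'a \<times> 'a set"
  define Q where "Q n s s' \<longleftrightarrow> (case s of (X, v, K) \<Rightarrow> case s' of (X', v', K') \<Rightarrow>
    v' \<in> K \<and> v' \<noteq> v \<and> conn (K - {v'}) \<and> X' = swapped X (side i n) v v')"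
    for n :: nat and s s' :: "(bool \<Rightarrow> 'a set) \<times> 'a \<times> 'a set"
  have component: "\<exists>K. conn K \<and> v \<in> K \<and> closed_in K (insert v (X j))" if st: "state X v" for X v j
    using component_exists[of "insert v (X j)" v] state_fin[OF st, of j] by (metis finite_insert insertI1)
  have "\<exists>s. P 0 s"
    using component[OF assms, of i] assms by (auto simp: P_def)
  moreover have "\<exists>s'. P (Suc n) s' \<and> Q n s s'" if Ps: "P n s" for n s
  proof -
    obtain X v K where s: "s = (X, v, K)" by (cases s)
    have *: "state X v" "conn K" "v \<in> K" "closed_in K (insert v (X (side i n)))"
      using Ps by (simp_all add: P_def s)
    have KX: "K \<subseteq> insert v (X (side i n))" using *(4) by (simp add: closed_in_def)
    then have fin: "finite K" using state_fin[OF *(1), of "side i n"] by (meson finite.insertI finite_subset)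
    have "deg True K v = r (side i n)" using component_regular[OF *] *(3) by (simp add: regular_def)
    moreover have "{w \<in> {v}. darc True v w} = {}" by auto
    ultimately have "K \<noteq> {v}" using r_pos[of "side i n"] by (metis deg_def card.empty not_one_le_zero)
    then obtain u where u: "u \<in> K" "u \<noteq> v" "conn (K - {u})"
      using conn_nonseparating[OF fin *(2,3)] by blast
    have st: "state (swapped X (side i n) v u) u" by (rule state_move[OF *(1-3) KX u(1)])
    obtain K' where K': "conn K'" "u \<in> K'"
        "closed_in K' (insert u (swapped X (side i n) v u (side i (Suc n))))"
      using component[OF st] by blast
    show ?thesis
      by (rule exI[of _ "(swapped X (side i n) v u, u, K')"]) (use st K' u s in \<open>simp add: P_def Q_def\<close>)
  qed
  ultimately obtain f where f: "\<And>n. P n (f n)" "\<And>n. Q n (f n) (f (Suc n))"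
    using dependent_nat_choice[of P Q] by blast
  define X v K where "X n = fst (f n)" and "v n = fst (snd (f n))" and "K n = snd (snd (f n))" for n
  have "P n (X n, v n, K n)" "Q n (X n, v n, K n) (X (Suc n), v (Suc n), K (Suc n))" for n
    using f[of n] by (simp_all add: X_def v_def K_def)
  then have "walk i X v K" "X 0 = X0" "v 0 = v0"
    unfolding walk_def P_def Q_def by auto
  then show ?thesis by blast
qed

lemma walk_shift:
  assumes "walk i X v K"
  shows "walk (side i k) (\<lambda>n. X (n + k)) (\<lambda>n. v (n + k)) (\<lambda>n. K (n + k))"
  using assms unfolding walk_def by (simp add: side_add)

text \<open>
  Before time \<open>t\<close> the walk has not come into contact with one of its own earlier trails.
\<close>

definition fresh :: "bool \<Rightarrow> (nat \<Rightarrow> 'a) \<Rightarrow> (nat \<Rightarrow> 'a set) \<Rightarrow> nat \<Rightarrow> bool" where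
  "fresh i v K t \<longleftrightarrow>
     (\<forall>k<t. \<forall>j<k. side i j = side i k \<longrightarrow> K k \<inter> (K j - {v (Suc j)}) = {})"

text \<open>
  A trail is a component of its side when it is left behind. It stays one as long as the later
  components on that side avoid it, since only vertices of these components are exchanged.
\<close>

lemma trail_persists:
  assumes W: "walk i X v K" and fr: "fresh i v K t" and "j < k" "k \<le> t"
  shows "closed_in (K j - {v (Suc j)}) (X k (side i j))"
proof -
  have "Suc j \<le> k" using assms(3) by simp
  then show ?thesis using assms(4)
  proof (induction k rule: dec_induct)
    case base
    show ?case using walkD(4,9)[OF W, of j] unfolding closed_in_def by auto
  next
    case (step k)
    define R where "R = K j - {v (Suc j)}"
    have cl: "closed_in R (X k (side i j))" using step by (simp add: R_def)
    show ?case
    proof (cases "side i k = side i j")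
      case False
      then have "X (Suc k) (side i j) = X k (side i j)" by (simp add: walkD(9)[OF W, of k])
      then show ?thesis using cl by (simp add: R_def)
    next
      case True
      have disj: "K k \<inter> R = {}"
        using fr step True unfolding fresh_def R_def by simp
      have "X (Suc k) (side i j) = insert (v k) (X k (side i j)) - {v (Suc k)}"
        by (simp add: walkD(9)[OF W, of k] True)
      moreover have "\<not> adj a (v k)" if a: "a \<in> R" for a
      proof
        assume "adj a (v k)"
        moreover have "a \<in> insert (v k) (X k (side i k))" "a \<notin> K k"
          using a cl disj True unfolding closed_in_def by auto
        ultimately show False
          using walkD(3,4)[OF W, of k] adj_sym unfolding closed_in_def by blast
      qed
      moreover have "v (Suc k) \<notin> R" using walkD(6)[OF W, of k] disj by blast
      ultimately show ?thesis using cl unfolding closed_in_def R_def by auto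
    qed
  qed
qed

lemma hole_in_trail: "walk i X v K \<Longrightarrow> v j \<in> K j - {v (Suc j)}"
  using walkD(3,7)[of i X v K j] by (metis DiffI singletonD)

lemma holes_distinct:
  assumes "walk i X v K" "fresh i v K t" "j < k" "k \<le> t"
  shows "v j \<noteq> v k"
  using trail_persists[OF assms] hole_in_trail[OF assms(1), of j] walkD(10)[OF assms(1), of k "side i j"]
  unfolding closed_in_def by (metis subsetD)

text \<open>
  Without a return all holes would be distinct: each is stored in its trail, and the trail persists.
\<close>

lemma first_return:
  assumes W: "walk i X v K"
  obtains j t where "fresh i v K t" "j < t" "side i j = side i t" "K t \<inter> (K j - {v (Suc j)}) \<noteq> {}"
proof -
  have "\<exists>j t. fresh i v K t \<and> j < t \<and> side i j = side i t \<and> K t \<inter> (K j - {v (Suc j)}) \<noteq> {}"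
  proof (rule ccontr)
    assume none: "\<not> ?thesis"
    have fr: "fresh i v K t" for t
    proof (induction t)
      case 0 show ?case by (simp add: fresh_def)
    next
      case (Suc t) then show ?case using none unfolding fresh_def by (metis less_Suc_eq)
    qed
    have "inj v"
      by (rule injI) (metis holes_distinct[OF W fr] linorder_neqE_nat order_refl)
    moreover have "range v \<subseteq> V" using state_in_V walkD(1)[OF W] by blast
    ultimately show False using finite_V finite_subset range_inj_infinite by blast
  qed
  then show thesis using that by blast
qed

text \<open>
  The contact at a return happens through the hole itself: the trail is closed on its side, so no
  other vertex of \<open>K t\<close> outside the trail can be adjacent to it.
\<close>

lemma return_contact:
  assumes W: "walk i X v K" and fr: "fresh i v K t" and jt: "j < t" "side i j = side i t"
    and hit: "K t \<inter> (K j - {v (Suc j)}) \<noteq> {}"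
  shows "Suc j < t" "\<exists>c\<in>K j - {v (Suc j)}. adj c (v t)"
    "regular (r (side i j)) (insert (v (Suc j)) (K j - {v (Suc j)}))"
    "v (Suc j) \<in> X t (\<not> side i j)"
proof -
  define R where "R = K j - {v (Suc j)}"
  have "t \<noteq> Suc j" using jt(2) by auto
  then show Sj: "Suc j < t" using jt(1) by simp
  have cl: "closed_in R (X t (side i t))" using trail_persists[OF W fr jt(1)] jt(2) by (simp add: R_def)
  have vt: "v t \<notin> R" using cl walkD(10)[OF W, of t] unfolding closed_in_def by blast
  have "K t \<inter> R \<subseteq> K t \<and> K t \<inter> R \<noteq> {} \<and> K t \<inter> R \<noteq> K t"
    using hit vt walkD(3)[OF W, of t] by (auto simp: R_def)
  then obtain a b where ab: "a \<in> K t \<inter> R" "b \<in> K t - K t \<inter> R" "adj a b"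
    using walkD(2)[OF W, of t] unfolding conn_def by meson
  have "b = v t" using ab cl walkD(5)[OF W, of t] unfolding closed_in_def by blast
  then show "\<exists>c\<in>K j - {v (Suc j)}. adj c (v t)" using ab by (auto simp: R_def)
  have "insert (v (Suc j)) R = K j" using walkD(6)[OF W, of j] by (auto simp: R_def)
  then show "regular (r (side i j)) (insert (v (Suc j)) (K j - {v (Suc j)}))"
    using component_regular[OF walkD(1,2,3,4)[OF W]] by (simp add: R_def)
  show "v (Suc j) \<in> X t (\<not> side i j)"
    using trail_persists[OF W fr Sj] hole_in_trail[OF W, of "Suc j"] unfolding closed_in_def by auto
qed

lemma state_exists: "\<exists>X v. state X v"
proof -
  obtain v where v: "v \<in> V" using V_nonempty by blast
  then show ?thesis using split_except_one[OF v] by (auto simp: state_def)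
qed

text \<open>
  At a return of time \<open>t\<close> to time \<open>j\<close>, the hole \<open>v t\<close> and \<open>v (j + 1)\<close> are twins for the trail of time
  \<open>j\<close>, while \<open>v (j + 2)\<close> completes the trail of time \<open>j + 1\<close>. This is the situation of
  \<open>return_clique\<close>; \<open>v (j + 2)\<close> may coincide with \<open>v t\<close>.
\<close>

lemma unsplittable_complete:
  assumes "r True + r False \<ge> 3"
  shows "biclique V"
proof -
  obtain X v K where W: "walk True X v K" using state_exists walk_exists by blast
  obtain j t where fr: "fresh True v K t" and jt: "j < t" "side True j = side True t"
    and hit: "K t \<inter> (K j - {v (Suc j)}) \<noteq> {}"
    using first_return[OF W] .
  define i where "i = side True j"
  note rc = return_contact[OF W fr jt hit]
  obtain c where c: "c \<in> K j - {v (Suc j)}" "adj c (v t)" using rc(2) by blast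
  have x: "v (Suc (Suc j)) \<in> insert (v t) (X t i)"
  proof (cases "t = Suc (Suc j)")
    case False
    then have "Suc (Suc j) < t" using rc(1) by simp
    from trail_persists[OF W fr this] show ?thesis
      using hole_in_trail[OF W, of "Suc (Suc j)"] unfolding closed_in_def i_def by auto
  qed simp
  have x': "v (Suc (Suc j)) \<notin> K j - {v (Suc j)}"
    using trail_persists[OF W fr, of j "Suc (Suc j)"] rc(1) walkD(10)[OF W, of "Suc (Suc j)"]
    unfolding closed_in_def by auto
  have "\<exists>Q\<subseteq>V. biclique Q \<and> card Q = r True + r False + 1"
  proof (rule return_clique[OF walkD(1)[OF W, of t] assms])
    show "closed_in (K j - {v (Suc j)}) (X t i)" using trail_persists[OF W fr jt(1)] by (simp add: i_def)
    show "conn (K j - {v (Suc j)})" using walkD(8)[OF W] .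
    show "v (Suc j) \<in> K (Suc j) - {v (Suc (Suc j))}" using hole_in_trail[OF W] .
    show "regular (r i) (insert (v (Suc j)) (K j - {v (Suc j)}))" using rc(3) by (simp add: i_def)
    show "closed_in (K (Suc j) - {v (Suc (Suc j))}) (X t (\<not> i))"
      using trail_persists[OF W fr rc(1)] by (simp add: i_def)
    show "conn (K (Suc j) - {v (Suc (Suc j))})" using walkD(8)[OF W] .
    have "insert (v (Suc (Suc j))) (K (Suc j) - {v (Suc (Suc j))}) = K (Suc j)"
      using walkD(6)[OF W, of "Suc j"] by blast
    then show "regular (r (\<not> i)) (insert (v (Suc (Suc j))) (K (Suc j) - {v (Suc (Suc j))}))"
      using component_regular[OF walkD(1,2,3,4)[OF W], of "Suc j"] by (simp add: i_def)
    show "v (Suc (Suc j)) \<in> insert (v t) (X t i) - (K j - {v (Suc j)})" using x x' by blast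
  qed (use c in auto)
  then show ?thesis using saturated_clique by blast
qed

lemma two_neighbours:
  assumes "\<And>i. r i = 1" "a \<in> V" "linked a b" "linked a c" "b \<noteq> c" "darc d a u"
  shows "u = b \<or> u = c"
proof -
  have in_V: "w \<in> V" if "darc e a w" for e w using that E_subset by (auto simp: darc_def split: if_splits)
  have "{b, c} \<subseteq> {w \<in> V. darc d a w}" using assms(3,4) in_V by (auto simp: linked_def)
  moreover have "card {w \<in> V. darc d a w} = card {b, c}"
    using deg_V[OF assms(2), of d] assms(1,5) by (simp add: deg_def)
  ultimately have "{b, c} = {w \<in> V. darc d a w}"
    using finite_V by (intro card_subset_eq) auto
  then show ?thesis using assms(6) in_V by blast
qed

section \<open>The bidirected odd cycle\<close>

text \<open>
  With \<open>r i = 1\<close>, a return to time \<open>j\<close> makes \<open>v t\<close> and \<open>v (j + 1)\<close> the only two neighbours of \<open>v j\<close>. For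
  \<open>j > 0\<close> the walk came to \<open>v j\<close> through \<open>K (j - 1)\<close>, and the neighbour of \<open>v j\<close> there lies in the trail of
  time \<open>j - 1\<close> and would be a third one. So the walk returns to its start, and it does so on the side
  on which it started, that is, at an even time.
\<close>

lemma walk_closes_up:
  assumes r1: "\<And>i. r i = 1" and W: "walk i X v K"
  obtains t where "fresh i v K t" "even t" "t \<ge> 2" "linked (v 0) (v (Suc 0))" "linked (v t) (v 0)"
proof -
  obtain j t where fr: "fresh i v K t" and jt: "j < t" "side i j = side i t"
    and hit: "K t \<inter> (K j - {v (Suc j)}) \<noteq> {}"
    using first_return[OF W] .
  note rc = return_contact[OF W fr jt hit]
  obtain c where c: "c \<in> K j - {v (Suc j)}" "adj c (v t)" using rc(2) by blast
  define R where "R = K j - {v (Suc j)}"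
  have cl: "biclique (insert (v t) R)" "biclique (insert (v (Suc j)) R)" "card R = 1"
    using twin_clique[OF walkD(1)[OF W], of R t "side i j" c "v (Suc j)"]
      trail_persists[OF W fr jt(1)] walkD(8)[OF W, of j] c rc(3,4) r1 unfolding R_def by auto
  have ne: "v j \<noteq> v t" "v j \<noteq> v (Suc j)" "v (Suc j) \<noteq> v t"
    using holes_distinct[OF W fr] rc(1) walkD(7)[OF W, of j] jt(1) by auto
  have "v j \<in> R" using hole_in_trail[OF W] by (simp add: R_def)
  then have lk: "linked (v j) (v t)" "linked (v j) (v (Suc j))" "linked (v t) (v j)"
    using cl(1,2) ne unfolding biclique_def by auto
  have "j = 0"
  proof (rule ccontr)
    assume "j \<noteq> 0"
    then obtain k where k: "j = Suc k" by (cases j) auto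
    have "deg True (K k) (v j) = 1"
      using component_regular[OF walkD(1,2,3,4)[OF W], of k] walkD(6)[OF W, of k] r1 k by (simp add: regular_def)
    then have "{y \<in> K k. darc True (v j) y} \<noteq> {}" unfolding deg_def by (metis card.empty zero_neq_one)
    then obtain y where y: "y \<in> K k" "darc True (v j) y" by blast
    then have "y \<noteq> v j" by auto
    then have "y \<in> X j' (side i k)" if "k < j'" "j' \<le> t" for j'
      using trail_persists[OF W fr that] y(1) k unfolding closed_in_def by blast
    then have "y \<noteq> v t" "y \<noteq> v (Suc j)"
      using walkD(10)[OF W] k rc(1) by (metis Suc_lessD order_refl lessI, metis less_imp_le_nat lessI less_SucI)
    then show False
      using two_neighbours[OF r1 state_in_V[OF walkD(1)[OF W]] lk(1,2) _ y(2)] ne by auto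
  qed
  moreover have "even t" using jt(2) \<open>j = 0\<close> by (auto simp: side_def split: if_splits)
  ultimately show thesis using that[OF fr] lk rc(1) by auto
qed

text \<open>
  Every tail of a walk is again a walk, so \<open>walk_closes_up\<close> links each hole to the next one. Up to the
  return, the holes form a bidirected cycle in which every vertex already has all its neighbours.
\<close>

lemma unsplittable_odd_cycle:
  assumes r1: "\<And>i. r i = 1"
  shows "\<exists>vs. distinct vs \<and> length vs \<ge> 3 \<and> odd (length vs) \<and> set vs = V \<and>
    E = {(u, w). {u, w} \<in> cycle_edges vs}"
proof -
  obtain X v K where W: "walk True X v K" using state_exists walk_exists by blast
  obtain t where t: "fresh True v K t" "even t" "t \<ge> 2" "linked (v t) (v 0)"
    using walk_closes_up[OF r1 W] .
  have step: "linked (v k) (v (Suc k))" for k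
    using walk_closes_up[OF r1 walk_shift[OF W, of k]] by (metis add_0 add_Suc)
  define vs where "vs = map v [0..<Suc t]"
  have len: "length vs = Suc t" by (simp add: vs_def)
  have nth: "vs ! k = v k" if "k \<le> t" for k using that by (simp add: vs_def nth_append)
  have inj: "v j = v k \<longleftrightarrow> j = k" if "j \<le> t" "k \<le> t" for j k
    using holes_distinct[OF W t(1), of j k] holes_distinct[OF W t(1), of k j] that
    by (metis linorder_neqE_nat)
  have dist: "distinct vs"
    unfolding distinct_conv_nth len using nth inj by (simp add: less_Suc_eq_le)
  have set_vs: "set vs = v ` {..t}" 
    by (simp only: vs_def set_map set_upt atLeast0LessThan lessThan_Suc_atMost)
  have edge_linked: "linked (v k) (vs ! (Suc k mod length vs))" if "k \<le> t" for k
  proof (cases "k = t")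
    case True then show ?thesis using t(4) nth[of 0] by (simp add: len)
  next
    case False then show ?thesis using step[of k] that nth[of "Suc k"] by (simp add: len)
  qed
  have vV: "v k \<in> V" for k using state_in_V[OF walkD(1)[OF W]] .
  have edge: "{v k, vs ! (Suc k mod length vs)} \<in> cycle_edges vs" if "k \<le> t" for k
    using that nth[OF that] unfolding cycle_edges_def len by (auto intro!: exI[of _ k])
  have nbr: "{v k, u} \<in> cycle_edges vs \<and> u \<in> set vs" if k: "k \<le> t" and a: "darc d (v k) u" for k u d
  proof -
    \<comment> \<open>\<open>p\<close> and \<open>n\<close> are the positions before and after \<open>k\<close> on the cycle.\<close>
    define p where "p = (if k = 0 then t else k - 1)"
    have p: "p \<le> t" "Suc p mod Suc t = k" using k by (auto simp: p_def)
    define n where "n = Suc k mod Suc t"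
    have n: "n \<le> t" "n \<noteq> p" using k t(3) by (auto simp: n_def p_def mod_Suc)
    have "linked (v k) (v n)" using edge_linked[OF k] nth[OF n(1)] by (simp add: len n_def)
    moreover have "linked (v k) (v p)" using edge_linked[OF p(1)] p(2) nth[OF k] linked_sym by (simp add: len)
    moreover have "v n \<noteq> v p" using inj n p(1) by simp
    ultimately have "u = v n \<or> u = v p" using two_neighbours[OF r1 vV] a by blast
    moreover have "{v k, v n} \<in> cycle_edges vs" using edge[OF k] nth[OF n(1)] by (simp add: len n_def)
    moreover have "{v k, v p} \<in> cycle_edges vs"
      using edge[OF p(1)] p(2) nth[OF k] by (simp add: len insert_commute)
    ultimately show ?thesis using n(1) p(1) set_vs by auto
  qed
  have V: "set vs = V"
  proof (rule ccontr)
    assume "set vs \<noteq> V"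
    moreover have "set vs \<subseteq> V" "set vs \<noteq> {}" using vV set_vs by auto
    ultimately obtain a b where "a \<in> set vs" "b \<in> V - set vs" "adj a b"
      using conn_V unfolding conn_def by meson
    then show False using nbr set_vs by (auto simp: adj_def)
  qed
  have "(u, w) \<in> E \<longleftrightarrow> {u, w} \<in> cycle_edges vs" for u w
  proof
    assume uw: "(u, w) \<in> E"
    then have "u \<in> set vs" using E_subset V by blast
    then obtain k where "k \<le> t" "u = v k" using set_vs by auto
    then show "{u, w} \<in> cycle_edges vs" using nbr[of k True w] uw by (simp add: darc_def)
  next
    assume "{u, w} \<in> cycle_edges vs"
    then obtain k where k: "k \<le> t" "{u, w} = {v k, vs ! (Suc k mod length vs)}"
      using nth unfolding cycle_edges_def len by (auto simp: less_Suc_eq_le)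
    have "linked u w" using k edge_linked[OF k(1)] linked_sym by (auto simp: doubleton_eq_iff)
    then show "(u, w) \<in> E" unfolding linked_def darc_def by (metis (full_types))
  qed
  then have "E = {(u, w). {u, w} \<in> cycle_edges vs}" by auto
  then show ?thesis using dist V t(2,3) len by auto
qed

end

section \<open>Degenerate colourings\<close>

context loopless_relation
begin

definition degenerate :: "nat \<Rightarrow> 'a set \<Rightarrow> bool" where
  "degenerate s X \<longleftrightarrow> (\<forall>U\<subseteq>X. U \<noteq> {} \<longrightarrow> (\<exists>v\<in>U. \<exists>d. deg d U v < s))"

definition colourable :: "nat \<Rightarrow> nat \<Rightarrow> 'a set \<Rightarrow> bool" where
  "colourable s q X \<longleftrightarrow>
     (\<exists>c :: 'a \<Rightarrow> nat. (\<forall>v\<in>X. c v < q) \<and> (\<forall>j<q. degenerate s {v \<in> X. c v = j}))"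

lemma degenerate_empty: "degenerate s {}"
  by (simp add: degenerate_def)

lemma degenerate_mono: "degenerate s X \<Longrightarrow> Y \<subseteq> X \<Longrightarrow> degenerate s Y"
  unfolding degenerate_def by (meson subset_trans)

lemma degenerate_insert:
  assumes "degenerate s X" "finite X" "deg d X v < s"
  shows "degenerate s (insert v X)"
  unfolding degenerate_def
proof (intro allI impI)
  fix U assume U: "U \<subseteq> insert v X" "U \<noteq> {}"
  show "\<exists>u\<in>U. \<exists>d. deg d U u < s"
  proof (cases "v \<in> U")
    case True
    have "deg d U v \<le> deg d X v"
      using deg_mono[of "insert v X" U d v] assms(2) U(1) by (simp add: deg_insert_self)
    then show ?thesis using True assms(3) le_less_trans by blast
  next
    case False
    then show ?thesis using assms(1) U unfolding degenerate_def by (metis subset_insert)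
  qed
qed

lemma colourable_empty: "colourable s q {}"
  by (auto simp: colourable_def degenerate_empty)

lemma colourable_mono:
  assumes "colourable s q X" "Y \<subseteq> X"
  shows "colourable s q Y"
proof -
  obtain c where c: "\<forall>v\<in>X. c v < q" "\<forall>j<q. degenerate s {v \<in> X. c v = j}"
    using assms(1) unfolding colourable_def by blast
  have "degenerate s {v \<in> Y. c v = j}" if "j < q" for j
    by (rule degenerate_mono[of s "{v \<in> X. c v = j}"]) (use c(2) that assms(2) in auto)
  then show ?thesis using c(1) assms(2) unfolding colourable_def by blast
qed

text \<open>
  By the pigeonhole principle \<open>v\<close> has fewer than \<open>s\<close> neighbours, in direction \<open>d\<close>, in some colour class.
\<close>

lemma colourable_insert:
  assumes "colourable s q X" "X \<subseteq> V" "v \<notin> X" "deg d X v < q * s"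
  shows "colourable s q (insert v X)"
proof -
  obtain c where c: "\<forall>v\<in>X. c v < q" "\<forall>j<q. degenerate s {v \<in> X. c v = j}"
    using assms(1) unfolding colourable_def by blast
  have fin: "finite X" using finite_sub assms(2) .
  have "\<exists>j<q. deg d {u \<in> X. c u = j} v < s"
  proof (rule ccontr)
    assume "\<not> ?thesis"
    then have "(\<Sum>j<q. s) \<le> (\<Sum>j<q. deg d {u \<in> X. c u = j} v)"
      by (intro sum_mono) (metis lessThan_iff not_less)
    also have "\<dots> = card (\<Union>j<q. {u \<in> {u \<in> X. c u = j}. darc d v u})"
      unfolding deg_def using fin by (intro card_UN_disjoint[symmetric]) auto
    also have "(\<Union>j<q. {u \<in> {u \<in> X. c u = j}. darc d v u}) = {u \<in> X. darc d v u}"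
      using c(1) by auto
    finally show False using assms(4) by (simp add: deg_def)
  qed
  then obtain j where j: "j < q" "deg d {u \<in> X. c u = j} v < s" by blast
  define c' where "c' = c(v := j)"
  have "degenerate s {u \<in> insert v X. c' u = k}" if "k < q" for k
  proof (cases "k = j")
    case True
    have "{u \<in> insert v X. c' u = k} = insert v {u \<in> X. c u = j}"
      using True assms(3) by (auto simp: c'_def)
    then show ?thesis using degenerate_insert[of s "{u \<in> X. c u = j}" d v] c(2) j fin by simp
  next
    case False
    then have "{u \<in> insert v X. c' u = k} = {u \<in> X. c u = k}"
      using assms(3) by (auto simp: c'_def)
    then show ?thesis using c(2) that by simp
  qed
  moreover have "\<forall>u\<in>insert v X. c' u < q" using c(1) j(1) by (simp add: c'_def)
  ultimately show ?thesis unfolding colourable_def by blast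
qed

lemma colourable_union:
  assumes "colourable s q X" "colourable s q' Y" "X \<inter> Y = {}"
  shows "colourable s (q + q') (X \<union> Y)"
proof -
  obtain c where c: "\<forall>v\<in>X. c v < q" "\<forall>j<q. degenerate s {v \<in> X. c v = j}"
    using assms(1) unfolding colourable_def by blast
  obtain c' where c': "\<forall>v\<in>Y. c' v < q'" "\<forall>j<q'. degenerate s {v \<in> Y. c' v = j}"
    using assms(2) unfolding colourable_def by blast
  define b where "b v = (if v \<in> X then c v else q + c' v)" for v
  have "degenerate s {v \<in> X \<union> Y. b v = j}" if "j < q + q'" for j
  proof (cases "j < q")
    case True
    then have "{v \<in> X \<union> Y. b v = j} = {v \<in> X. c v = j}" by (auto simp: b_def)
    then show ?thesis using c(2) True by simp
  next
    case False
    then have "{v \<in> X \<union> Y. b v = j} = {v \<in> Y. c' v = j - q}"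
      using c(1) assms(3) by (auto simp: b_def)
    then show ?thesis using c'(2) False that by simp
  qed
  moreover have "\<forall>v\<in>X \<union> Y. b v < q + q'" using c(1) c'(1) by (auto simp: b_def trans_less_add1)
  ultimately show ?thesis unfolding colourable_def by blast
qed

text \<open>
  The split into one colour and the other \<open>p - 1\<close> colours makes both sides non-trivial as soon as
  \<open>p \<ge> 2\<close>. The sum \<open>r True + r False = p * s\<close> is then at least \<open>2\<close>, with equality only for \<open>p = 2\<close> and
  \<open>s = 1\<close>: this is where odd cycles come in. For \<open>p = 1\<close> the second side admits only the empty set, and
  greedy colouring suffices.
\<close>

theorem brooks_degenerate:
  assumes conn: "conn V" "V \<noteq> {}" and s: "s \<ge> 1"
    and deg_le: "\<And>v d. v \<in> V \<Longrightarrow> deg d V v \<le> p * s"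
    and not_complete: "\<not> biclique V" and not_regular: "\<not> regular s V"
    and not_odd_cycle: "\<nexists>vs. distinct vs \<and> length vs \<ge> 3 \<and> odd (length vs) \<and> set vs = V \<and>
      E = {(u, w). {u, w} \<in> cycle_edges vs}"
  shows "colourable s p V"
proof (rule ccontr)
  assume not_col: "\<not> colourable s p V"
  have "p \<noteq> 0"
  proof
    assume "p = 0"
    obtain u w where "u \<in> V" "w \<in> V" "u \<noteq> w" using not_complete by (auto simp: biclique_def)
    then have "{u} \<subseteq> V \<and> {u} \<noteq> {} \<and> {u} \<noteq> V" by auto
    then obtain b where "b \<in> V - {u}" "adj u b" using conn(1) unfolding conn_def by blast
    then obtain d where "b \<in> {x \<in> V. darc d u x}" by (auto simp: adj_def)
    then have "deg d V u \<noteq> 0" unfolding deg_def using finite_V by auto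
    then show False using deg_le[OF \<open>u \<in> V\<close>, of d] \<open>p = 0\<close> by simp
  qed
  then have p: "p = 1 + (p - 1)" by simp
  define q where "q i = (if i then 1 else p - 1)" for i
  have ps: "q True * s + q False * s = p * s" using \<open>p \<noteq> 0\<close> by (cases p) (simp_all add: q_def)
  interpret split_families V E "\<lambda>i. colourable s (q i)" "\<lambda>i. q i * s"
  proof
    show "deg d V v \<le> q True * s + q False * s" if "v \<in> V" for v d
      using deg_le[OF that, of d] ps by simp
  qed (use colourable_empty colourable_mono colourable_insert conn in \<open>blast+\<close>)
  have nosplit: "\<not> split_of X V" for X
  proof
    assume "split_of X V"
    then have "colourable s (q True + q False) V"
      using colourable_union[of s "q True" "X True" "q False" "X False"] unfolding split_of_def by auto
    then show False using not_col p by (simp add: q_def)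
  qed
  show False
  proof (cases "p = 1")
    case True
    have "deg d V v = s" if "v \<in> V" for v d
      using split_low_degree[OF that, of d] nosplit deg_le[OF that, of d] True by (fastforce simp: q_def)
    then show False using not_regular by (simp add: regular_def)
  next
    case False
    then have p2: "p \<ge> 2" using \<open>p \<noteq> 0\<close> by simp
    interpret unsplittable V E "\<lambda>i. colourable s (q i)" "\<lambda>i. q i * s"
      by unfold_locales (use s p2 nosplit conn in \<open>auto simp: q_def\<close>)
    show False
    proof (cases "q True * s + q False * s \<ge> 3")
      case True
      then show False using unsplittable_complete not_complete by blast
    next
      case False
      then have "p * s < 3" using ps by simp
      moreover have "p * s \<ge> p" "p * s \<ge> 2 * s" using p2 s by auto
      ultimately have "p = 2" "s = 1" using p2 s by linarith+
      then have "q i * s = 1" for i by (simp add: q_def)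
      then show False using unsplittable_odd_cycle not_odd_cycle by blast
    qed
  qed
qed

end

section \<open>Degrees and connectedness of digraphs\<close>

lemma connected_loopless_relation:
  assumes "digraph D" "Digraph_Component.connected D"
  shows "loopless_relation (verts D) (arcs_ends D)"
    and "loopless_relation.conn (arcs_ends D) (verts D)"
proof -
  interpret digraph D by fact
  show rel: "loopless_relation (verts D) (arcs_ends D)"
    by unfold_locales (auto simp: arcs_ends_conv dest: no_loops)
  interpret loopless_relation "verts D" "arcs_ends D" by fact
  show "conn (verts D)"
    unfolding conn_def
  proof (intro allI impI, rule ccontr)
    fix A assume A: "A \<subseteq> verts D \<and> A \<noteq> {} \<and> A \<noteq> verts D"
      and none: "\<not> (\<exists>a\<in>A. \<exists>b\<in>verts D - A. adj a b)"
    then obtain a b where ab: "a \<in> A" "b \<in> verts D - A" "a \<in> verts D" by blast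
    then have "(a, b) \<in> rtrancl_on (verts D) (arcs_ends (with_proj (mk_symmetric D)))"
      using assms(2) unfolding Digraph_Component.connected_def strongly_connected_def reachable_def by auto
    then have "b \<in> A"
    proof (induction rule: rtrancl_on_induct)
      case (step y z)
      then have "(y, z) \<in> arcs_ends D \<or> (z, y) \<in> arcs_ends D"
        by (auto simp: parcs_mk_symmetric arcs_ends_conv)
      then have "adj y z" by (simp add: adj_def darc_def ex_bool_eq)
      then show ?case using none step by blast
    qed (use ab in simp)
    then show False using ab(2) by blast
  qed
qed

text \<open>
  A subgraph may lack arcs between its vertices. Degrees into its vertex set are thus only
  upper bounds, which is the direction that degeneracy of all subgraphs needs.
\<close>

lemma subgraph_degree_le:
  assumes "digraph D" "subgraph H D"
  shows "out_degree H v \<le> card {u \<in> verts H. (v, u) \<in> arcs_ends D}"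
    and "in_degree H v \<le> card {u \<in> verts H. (u, v) \<in> arcs_ends D}"
proof -
  interpret digraph D by fact
  interpret H: wf_digraph H using assms(2) by blast
  have H: "arcs H \<subseteq> arcs D" "tail H = tail D" "head H = head D" "verts H \<subseteq> verts D"
    using assms(2) by (auto simp: subgraph_def compatible_def)
  have fin: "finite (verts H)" using H(4) finite_verts finite_subset by blast
  show "out_degree H v \<le> card {u \<in> verts H. (v, u) \<in> arcs_ends D}"
    unfolding out_degree_def
  proof (rule card_inj_on_le)
    show "inj_on (head D) (out_arcs H v)"
      by (intro inj_onI no_multi_arcs) (use H in \<open>auto simp: out_arcs_def arc_to_ends_def\<close>)
    show "head D ` out_arcs H v \<subseteq> {u \<in> verts H. (v, u) \<in> arcs_ends D}"
      using H H.head_in_verts by (auto simp: out_arcs_def arcs_ends_conv)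
  qed (use fin in simp)
  show "in_degree H v \<le> card {u \<in> verts H. (u, v) \<in> arcs_ends D}"
    unfolding in_degree_def
  proof (rule card_inj_on_le)
    show "inj_on (tail D) (in_arcs H v)"
      by (intro inj_onI no_multi_arcs) (use H in \<open>auto simp: in_arcs_def arc_to_ends_def\<close>)
    show "tail D ` in_arcs H v \<subseteq> {u \<in> verts H. (u, v) \<in> arcs_ends D}"
      using H H.tail_in_verts by (auto simp: in_arcs_def arcs_ends_conv)
  qed (use fin in simp)
qed

lemma degree_eq:
  assumes "digraph D"
  shows "out_degree D v = card {u \<in> verts D. (v, u) \<in> arcs_ends D}"
    and "in_degree D v = card {u \<in> verts D. (u, v) \<in> arcs_ends D}"
proof -
  interpret digraph D by fact
  have "subgraph D D" using wf_digraph_axioms by (simp add: subgraph_def compatible_def)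
  note le = subgraph_degree_le[OF assms this]
  have "{u \<in> verts D. (v, u) \<in> arcs_ends D} \<subseteq> head D ` out_arcs D v"
    by (auto simp: out_arcs_def arcs_ends_conv)
  then have "card {u \<in> verts D. (v, u) \<in> arcs_ends D} \<le> out_degree D v"
    unfolding out_degree_def by (rule surj_card_le[OF finite_out_arcs])
  then show "out_degree D v = card {u \<in> verts D. (v, u) \<in> arcs_ends D}" using le(1) by (rule antisym[rotated])
  have "{u \<in> verts D. (u, v) \<in> arcs_ends D} \<subseteq> tail D ` in_arcs D v"
    by (auto simp: in_arcs_def arcs_ends_conv)
  then have "card {u \<in> verts D. (u, v) \<in> arcs_ends D} \<le> in_degree D v"
    unfolding in_degree_def by (rule surj_card_le[OF finite_in_arcs])
  then show "in_degree D v = card {u \<in> verts D. (u, v) \<in> arcs_ends D}" using le(2) by (rule antisym[rotated])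
qed

theorem theorem10:
  fixes D :: "('a, 'b) pre_digraph" and s m p :: nat
  assumes "digraph D"
    and "Digraph_Component.connected D"
    and "m = Max ((\<lambda>v. max (out_degree D v) (in_degree D v)) ` verts D)"
    and "s \<ge> 1"
    and "p = nat \<lceil>real m / real s\<rceil>"
    and "\<not> bidirected_odd_cycle D"
    and "\<not> bidirected_complete D"
    and "\<not> (eulerian D \<and> (\<forall>v\<in>verts D. in_degree D v = s \<and> out_degree D v = s))"
  shows "dichromatic_number s D \<le> p"
proof -
  interpret digraph D by fact
  interpret loopless_relation "verts D" "arcs_ends D"
    by (rule connected_loopless_relation(1)[OF assms(1,2)])
  have deg_out: "deg True U v = card {u \<in> U. (v, u) \<in> arcs_ends D}"
    and deg_in: "deg False U v = card {u \<in> U. (u, v) \<in> arcs_ends D}" for U v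
    by (simp_all add: deg_def darc_def)
  have degs: "deg True (verts D) v = out_degree D v" "deg False (verts D) v = in_degree D v" for v
    by (simp_all add: deg_out deg_in degree_eq[OF assms(1)])
  have nonempty: "verts D \<noteq> {}"
    using assms(2) by (auto simp: Digraph_Component.connected_def strongly_connected_def)
  have "colourable s p (verts D)"
  proof (rule brooks_degenerate)
    show "conn (verts D)" by (rule connected_loopless_relation(2)[OF assms(1,2)])
    have "real m / real s \<le> real p" using assms(5) by linarith
    then have "real m \<le> real (p * s)" using assms(4) by (simp add: field_simps)
    then have "m \<le> p * s" by linarith
    moreover have "deg d (verts D) v \<le> m" if "v \<in> verts D" for v d
    proof -
      have "max (out_degree D v) (in_degree D v) \<le> m"
        unfolding assms(3) using that by (intro Max_ge) auto
      then show ?thesis by (cases d) (simp_all add: degs)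
    qed
    ultimately show "deg d (verts D) v \<le> p * s" if "v \<in> verts D" for v d
      using that le_trans by blast
    show "\<not> biclique (verts D)"
    proof
      assume "biclique (verts D)"
      then have ends: "arcs_ends D = {(u, v). (u, v) \<in> verts D \<times> verts D \<and> u \<noteq> v}"
        using E_subset irrefl unfolding biclique_def linked_def darc_def by fastforce
      then have "symmetric D" by (auto simp: symmetric_def intro: symI)
      then have "complete_digraph (card (verts D)) D"
        using ends graphI by (simp add: complete_digraph_def)
      moreover have "card (verts D) \<ge> 1" using nonempty by (simp add: Suc_leI card_gt_0_iff)
      ultimately show False using assms(7) by (auto simp: bidirected_complete_def)
    qed
    show "\<not> regular s (verts D)"
    proof
      assume "regular s (verts D)"
      then have "deg d (verts D) v = s" if "v \<in> verts D" for v d using that by (simp add: regular_def)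
      then have "out_degree D v = s" "in_degree D v = s" if "v \<in> verts D" for v
        using degs that by metis+
      then show False using assms(8) by (simp add: eulerian_def)
    qed
    show "\<nexists>vs. distinct vs \<and> length vs \<ge> 3 \<and> odd (length vs) \<and> set vs = verts D \<and>
      arcs_ends D = {(u, w). {u, w} \<in> cycle_edges vs}"
    proof
      assume "\<exists>vs. distinct vs \<and> length vs \<ge> 3 \<and> odd (length vs) \<and> set vs = verts D \<and>
        arcs_ends D = {(u, w). {u, w} \<in> cycle_edges vs}"
      then obtain vs where vs: "distinct vs" "length vs \<ge> 3" "odd (length vs)" "set vs = verts D"
        "arcs_ends D = {(u, w). {u, w} \<in> cycle_edges vs}" by blast
      have "e \<subseteq> set vs \<and> card e = 2" if e: "e \<in> cycle_edges vs" for e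
      proof -
        obtain i where i: "i < length vs" "e = {vs ! i, vs ! (Suc i mod length vs)}"
          using e by (auto simp: cycle_edges_def)
        have "Suc i mod length vs < length vs" "Suc i mod length vs \<noteq> i"
          using i(1) vs(2) by (auto simp: mod_Suc)
        then show ?thesis using i vs(1) by (auto simp: nth_eq_iff_index_eq)
      qed
      then have "bidirects (set vs) (cycle_edges vs) D"
        using vs(4,5) assms(1) by (simp add: bidirects_def)
      then show False using vs(1-3) assms(6) by (auto simp: bidirected_odd_cycle_def)
    qed
  qed (use nonempty assms(4) in auto)
  then obtain c where c: "\<forall>v\<in>verts D. c v < p" "\<forall>j<p. degenerate s {v \<in> verts D. c v = j}"
    unfolding colourable_def by blast
  \<comment> \<open>Colours start at \<open>0\<close>, the parts of a partition are numbered from \<open>1\<close>.\<close>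
  define P where "P i = D \<restriction> {v \<in> verts D. c v = i - 1}" for i
  have P_verts: "verts (P i) = {v \<in> verts D. c v = i - 1}" for i by (simp add: P_def)
  have P_induced: "induced_subgraph (P i) D" for i
    unfolding P_def by (rule induced_induce) auto
  have "digraph_partition p D P"
  proof -
    have "disjoint_family_on (\<lambda>i. verts (P i)) {1..p}"
      by (auto simp: disjoint_family_on_def P_verts)
    moreover have "verts D = (\<Union>i\<in>{1..p}. verts (P i))"
    proof (rule set_eqI)
      fix v show "v \<in> verts D \<longleftrightarrow> v \<in> (\<Union>i\<in>{1..p}. verts (P i))"
        using c(1) by (auto simp: P_verts intro!: bexI[of _ "Suc (c v)"] Suc_leI)
    qed
    ultimately show ?thesis using P_induced by (simp add: digraph_partition_def)
  qed
  moreover have "weakly_degenerate s (P i)" if i: "i \<in> {1..p}" for i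
    unfolding weakly_degenerate_def
  proof (intro allI impI)
    fix H assume H: "subgraph H (P i) \<and> verts H \<noteq> {}"
    then have HD: "subgraph H D" using P_induced[of i] subgraph_trans induced_imp_subgraph by blast
    have "verts H \<subseteq> {v \<in> verts D. c v = i - 1}" using H P_verts[of i] by (auto simp: subgraph_def)
    moreover have "i - 1 < p" using i by auto
    ultimately obtain v d where v: "v \<in> verts H" "deg d (verts H) v < s"
      using c(2) H unfolding degenerate_def by meson
    have "min (out_degree H v) (in_degree H v) < s"
      using v(2) subgraph_degree_le[OF assms(1) HD, of v] by (cases d) (auto simp: deg_out deg_in)
    then show "\<exists>v\<in>verts H. min (out_degree H v) (in_degree H v) < s" using v(1) by blast
  qed
  ultimately show ?thesis
    unfolding dichromatic_number_def by (intro Least_le) blast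
qed

end
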